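(* Let $t$ be the (large negative) real root, $t\approx-262537412640768768$, of $$t^3+262537412640768768\,t^2+196608\,t+16777216=0,$$ and let $\alpha$ be the unique real root, which is positive, of $$668649972819460401\,Y^3+50012252033677839\,Y^2+1467\,Y-41450311432931=0.$$ Put $$S=\frac{t-64}{t+64},\qquad \rho=\sqrt{\frac{t+256}{t+64}}>0,\qquad \lambda=\frac{(t+256)(64-t)}{(512-t)(t+64)},\qquad \mu=-\frac{96t}{(t+256)(64-t)},$$ $$A=\frac{\alpha-S\mu}{\rho},\qquad B=\frac{S}{\rho\lambda}.$$ Then $$\sqrt{163}\,A=\frac{13591409}{426880\sqrt{10005}},\qquad \sqrt{163}\,B=\frac{272570067}{213440\sqrt{10005}}.$$ Consequently, with $\xi=\frac{256t}{(t+64)^2}$ and $z=\frac{1728t^2}{(t+256)^3}=-\frac{1}{53360^3}$, the cubic $\Gamma_0(2)^+$ Fricke linear form at $D=-163$ transforms exactly into the normalized Chudnovsky linear form: $$\sqrt{163}\left[\alpha F_2(\xi)+S\,(\theta_XF_2)(\xi)\right]=\frac{13591409}{426880\sqrt{10005}}\,F_1(z)+\frac{272570067}{213440\sqrt{10005}}\,(\theta_zF_1)(z).$$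
   Context: Notation: $F_1(z)={}_3F_2\!\left(\frac16,\frac12,\frac56;1,1;z\right)$, $F_2(X)={}_3F_2\!\left(\frac14,\frac12,\frac34;1,1;X\right)=\sum_{n\ge0}\frac{(4n)!}{256^n(n!)^4}X^n$, $\theta_z=z\frac{d}{dz}$, $\theta_X=X\frac{d}{dX}$. Square roots of positive reals are positive. The real root $t$ is the value, on the real Fricke-cusp branch, of the level-two Hauptmodul $(\eta(\tau)/\eta(2\tau))^{24}$ at $\tau=\frac{1+\sqrt{-163}}2$. *)

theory Defs
  imports "HOL-Analysis.Analysis"
begin

(* fps_hypergeo divides the n-th coefficient by fact n in addition to the
   Pochhammer symbols of the lower parameters, which is the usual convention.
   Where the power series does not converge, hyp_3F2 has no meaning. *)
definition hyp_3F2 :: "real \<Rightarrow> real \<Rightarrow> real \<Rightarrow> real \<Rightarrow> real \<Rightarrow> real \<Rightarrow> real" where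
  "hyp_3F2 a b c d e x = eval_fps (fps_hypergeo [a, b, c] [d, e] 1) x"

definition F1 :: "real \<Rightarrow> real" where
  "F1 = hyp_3F2 (1/6) (1/2) (5/6) 1 1"

definition F2 :: "real \<Rightarrow> real" where
  "F2 = hyp_3F2 (1/4) (1/2) (3/4) 1 1"

definition theta :: "(real \<Rightarrow> real) \<Rightarrow> real \<Rightarrow> real" where
  "theta f x = x * deriv f x"

lemma F2_coeff:
  "fps_nth (fps_hypergeo [1/4, 1/2, 3/4] [1, 1] (1::real)) n
     = fact (4 * n) / (256 ^ n * fact n ^ 4)"
proof -
  have eq: "pochhammer (1/4) n * pochhammer (1/2) n * pochhammer (3/4) n * (256 ^ n * fact n)
      = (fact (4 * n) :: real)"
  proof (induction n)
    case 0
    show ?case by simp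
  next
    case (Suc n)
    have "fact (4 * Suc n) = (fact (Suc (Suc (Suc (Suc (4 * n))))) :: real)"
      by (rule arg_cong[where f = fact]) simp
    also have "\<dots> = (4 * real n + 4) * (4 * real n + 3) * (4 * real n + 2) * (4 * real n + 1)
        * fact (4 * n)"
      unfolding fact_Suc by (simp add: algebra_simps)
    also have "\<dots> = ((1/4 + real n) * (1/2 + real n) * (3/4 + real n) * (256 * (real n + 1)))
        * fact (4 * n)"
      by (simp add: algebra_simps)
    also have "\<dots> = pochhammer (1/4) (Suc n) * pochhammer (1/2) (Suc n)
        * pochhammer (3/4) (Suc n) * (256 ^ Suc n * fact (Suc n))"
      unfolding Suc.IH[symmetric] pochhammer_Suc fact_Suc power_Suc of_nat_Suc
      by (simp only: mult_ac add.commute)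
    finally show ?case by simp
  qed
  show ?thesis
    unfolding eq[symmetric] by (simp add: pochhammer_fact[symmetric] power4_eq_xxxx)
qed

lemma F2_series: "F2 x = (\<Sum>n. fact (4 * n) / (256 ^ n * fact n ^ 4) * x ^ n)"
  unfolding F2_def hyp_3F2_def eval_fps_def F2_coeff ..

end

theory Submission
  imports Defs
begin

text \<open>Both series are attached to weight-two modular forms: $F_1$ to level one, with argument $1728/j$,
and $F_2$ to the group $\Gamma_0(2)^+$. In terms of the Hauptmodul $t$ one has
$j = (t+256)^3/t^2$, and so the two are related by an algebraic transformation
\[ F_1\left(\frac{1728t^2}{(t+256)^3}\right)
   = \sqrt{\frac{t+256}{t+64}}\; F_2\left(\frac{256t}{(t+64)^2}\right), \]
valid near the cusp $t = \infty$. Its logarithmic derivative expresses $\theta F_1$ through $F_2$ and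
$\theta F_2$; solving for $F_2$ and $\theta F_2$ produces precisely the coefficients $A$ and $B$.

The transformation is proved without modular forms. In the cusp coordinate $u = 1/t$ the Euler
operator $\theta = u\,d/du$ turns the third-order hypergeometric equations into first-order systems
for the jets $(F, \theta F, \theta^2 F)$. The jet of $F_2$, multiplied by the matrix that the
claimed identity forces, satisfies the same system as the jet of $F_1$
(\<open>theta_transferred_jet0\<close>, \<open>theta_transferred_jet1\<close>, \<open>theta_transferred_jet2\<close>), and both have the
value $(1,0,0)$ at $u = 0$. The system is singular at $u = 0$, but its residue matrix is nilpotent, so a
solution that is differentiable there is determined by its value at $0$
(\<open>theta_system_unique\<close>). A mean value estimate shows this on $|u| \le 10^{-6}$, which contains the
point needed, $u \approx -3.8 \cdot 10^{-18}$.

The rest is arithmetic. The cubic equation of $t$ says that $(t+256)^3 = -640320^3\,t^2$, which is the value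
of $z$. The equation $B^2 = 1 - z$, an identity in $t$, gives $B$. For $A$, the number
$S\mu + k S/\lambda$ with $k = 13591409/545140134$ is a rational function of $t$ and is a root of the
cubic of $\alpha$ (\<open>alpha_cubic_of_hauptmodul_cubic\<close>); hence it equals $\alpha$, and $A = kB$. Both cubics have a
negative discriminant, which makes their real roots unique (\<open>cubic_root_unique\<close>).\<close>

section \<open>The Euler derivative at a point\<close>

text \<open>A relational form of the Euler derivative: it includes differentiability, so that one
fact carries both, also at $u = 0$, where the value alone says nothing about the derivative.\<close>

definition has_theta_deriv :: "(real \<Rightarrow> real) \<Rightarrow> real \<Rightarrow> real \<Rightarrow> bool" where
  "has_theta_deriv f c u \<longleftrightarrow> (\<exists>D. (f has_real_derivative D) (at u) \<and> u * D = c)"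

lemma has_theta_derivI:
  "(f has_real_derivative D) (at u) \<Longrightarrow> u * D = c \<Longrightarrow> has_theta_deriv f c u"
  unfolding has_theta_deriv_def by blast

lemma has_theta_deriv_imp_theta:
  "has_theta_deriv f c u \<Longrightarrow> theta f u = c"
  unfolding has_theta_deriv_def theta_def by (auto dest: DERIV_imp_deriv)

lemma has_theta_deriv_add:
  "has_theta_deriv f c u \<Longrightarrow> has_theta_deriv g d u \<Longrightarrow> has_theta_deriv (\<lambda>x. f x + g x) (c + d) u"
  unfolding has_theta_deriv_def by (metis DERIV_add distrib_left)

lemma has_theta_deriv_diff:
  "has_theta_deriv f c u \<Longrightarrow> has_theta_deriv g d u \<Longrightarrow> has_theta_deriv (\<lambda>x. f x - g x) (c - d) u"
  unfolding has_theta_deriv_def by (metis DERIV_diff right_diff_distrib)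

lemma has_theta_deriv_mult:
  assumes "has_theta_deriv f c u" "has_theta_deriv g d u"
  shows "has_theta_deriv (\<lambda>x. f x * g x) (c * g u + f u * d) u"
proof -
  obtain C D where *: "(f has_real_derivative C) (at u)" "u * C = c"
      "(g has_real_derivative D) (at u)" "u * D = d"
    using assms unfolding has_theta_deriv_def by blast
  show ?thesis
    by (rule has_theta_derivI[OF DERIV_mult[OF *(1,3)]])
       (use *(2,4) in \<open>auto simp: algebra_simps\<close>)
qed

text \<open>The chain rule is simplest when the inner function is described by its logarithmic derivative
\<open>\<kappa>\<close>: then $\theta(f \circ \phi) = \kappa \cdot (\theta f) \circ \phi$.\<close>

lemma has_theta_deriv_compose:
  assumes "has_theta_deriv \<phi> (\<phi> u * \<kappa>) u" "has_theta_deriv f c (\<phi> u)"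
  shows "has_theta_deriv (\<lambda>x. f (\<phi> x)) (\<kappa> * c) u"
proof -
  obtain C D where *: "(\<phi> has_real_derivative C) (at u)" "u * C = \<phi> u * \<kappa>"
      "(f has_real_derivative D) (at (\<phi> u))" "\<phi> u * D = c"
    using assms unfolding has_theta_deriv_def by blast
  have "u * (D * C) = D * (u * C)" by simp
  also have "\<dots> = \<kappa> * c" by (simp add: *(2) *(4)[symmetric])
  finally show ?thesis
    by (intro has_theta_derivI[OF DERIV_chain2[OF *(3,1)]])
qed

section \<open>Uniqueness for nilpotent Euler systems\<close>

text \<open>The factor $x$ in the Euler derivative cancels against the one in the bound, which leaves a bound for the
ordinary derivative away from $0$; the mean value theorem integrates it. This is how one
estimate gains a factor $|u|$.\<close>

lemma theta_growth:
  fixes f c :: "real \<Rightarrow> real"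
  assumes f: "\<And>x. \<bar>x\<bar> \<le> r \<Longrightarrow> has_theta_deriv f (c x) x"
    and c: "\<And>x. \<bar>x\<bar> \<le> r \<Longrightarrow> \<bar>c x\<bar> \<le> C * \<bar>x\<bar>"
    and f0: "f 0 = 0" and u: "\<bar>u\<bar> \<le> r"
  shows "\<bar>f u\<bar> \<le> C * \<bar>u\<bar>"
proof (cases "u = 0")
  case True
  then show ?thesis using f0 by simp
next
  case False
  have der: "(f has_real_derivative deriv f x) (at x)" "x * deriv f x = c x" if "\<bar>x\<bar> \<le> r" for x
    using f[OF that] unfolding has_theta_deriv_def by (auto dest: DERIV_imp_deriv)
  have bound: "\<bar>deriv f x\<bar> \<le> C" if "\<bar>x\<bar> \<le> r" "x \<noteq> 0" for x
  proof -
    have "\<bar>x\<bar> * \<bar>deriv f x\<bar> \<le> \<bar>x\<bar> * C"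
      using c[OF that(1)] der(2)[OF that(1)] by (simp add: abs_mult[symmetric] mult.commute)
    then show ?thesis using that(2) by simp
  qed
  obtain x where x: "\<bar>x\<bar> \<le> r" "x \<noteq> 0" "f u = u * deriv f x"
  proof (cases "u > 0")
    case True
    have "\<exists>x. 0 < x \<and> x < u \<and> f u - f 0 = (u - 0) * deriv f x"
      by (rule MVT2[OF True]) (use u in \<open>auto intro!: der(1)\<close>)
    then obtain x where "0 < x" "x < u" "f u = u * deriv f x" using f0 by auto
    then show ?thesis using that[of x] u by auto
  next
    case notpos: False
    then have "u < 0" using False by simp
    have "\<exists>x. u < x \<and> x < 0 \<and> f 0 - f u = (0 - u) * deriv f x"
      by (rule MVT2[OF \<open>u < 0\<close>]) (use u in \<open>auto intro!: der(1)\<close>)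
    then obtain x where "u < x" "x < 0" "f u = u * deriv f x" using f0 by auto
    then show ?thesis using that[of x] u by auto
  qed
  have "\<bar>f u\<bar> = \<bar>u\<bar> * \<bar>deriv f x\<bar>" by (simp add: x(3) abs_mult)
  also have "\<dots> \<le> \<bar>u\<bar> * C" using bound[OF x(1,2)] by (intro mult_left_mono) auto
  finally show ?thesis by (simp add: mult.commute)
qed

text \<open>Let $M$ be the maximum of $|E_0|+|E_1|+|E_2|$. The last equation has a factor $x$ on its right-hand side,
so \<open>theta_growth\<close> bounds $|E_2|$ by $KM|x|$; the nilpotent shape of the other two equations passes this bound
on to $E_1$ and then to $E_0$, at the cost of a factor $L$ each time. At a maximum point the sum of
the bounds is smaller than $M$ unless $M = 0$.\<close>

lemma theta_system_unique:
  fixes E0 E1 E2 c0 c1 c2 :: "real \<Rightarrow> real"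
  assumes r: "0 < r" and L: "0 \<le> L" and K: "0 \<le> K"
    and small: "(L\<^sup>2 + L + 1) * K * r < 1"
    and E0: "\<And>x. \<bar>x\<bar> \<le> r \<Longrightarrow> has_theta_deriv E0 (c0 x) x"
    and E1: "\<And>x. \<bar>x\<bar> \<le> r \<Longrightarrow> has_theta_deriv E1 (c1 x) x"
    and E2: "\<And>x. \<bar>x\<bar> \<le> r \<Longrightarrow> has_theta_deriv E2 (c2 x) x"
    and c0: "\<And>x. \<bar>x\<bar> \<le> r \<Longrightarrow> \<bar>c0 x\<bar> \<le> L * \<bar>E1 x\<bar>"
    and c1: "\<And>x. \<bar>x\<bar> \<le> r \<Longrightarrow> \<bar>c1 x\<bar> \<le> L * \<bar>E2 x\<bar>"
    and c2: "\<And>x. \<bar>x\<bar> \<le> r \<Longrightarrow> \<bar>c2 x\<bar> \<le> K * \<bar>x\<bar> * (\<bar>E0 x\<bar> + \<bar>E1 x\<bar> + \<bar>E2 x\<bar>)"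
    and init: "E0 0 = 0" "E1 0 = 0" "E2 0 = 0"
    and u: "\<bar>u\<bar> \<le> r"
  shows "E0 u = 0 \<and> E1 u = 0 \<and> E2 u = 0"
proof -
  define N where "N = (\<lambda>x. \<bar>E0 x\<bar> + \<bar>E1 x\<bar> + \<bar>E2 x\<bar>)"
  have cont: "isCont E0 x" "isCont E1 x" "isCont E2 x" if "\<bar>x\<bar> \<le> r" for x
    using E0[OF that] E1[OF that] E2[OF that] unfolding has_theta_deriv_def
    by (auto dest: DERIV_isCont)
  have "continuous_on {-r..r} N"
    unfolding N_def by (intro continuous_at_imp_continuous_on ballI continuous_intros)
      (auto intro!: cont)
  then obtain v where v: "v \<in> {-r..r}" "\<And>x. x \<in> {-r..r} \<Longrightarrow> N x \<le> N v"
    using continuous_attains_sup[of "{-r..r}" N] r by auto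
  define M where "M = N v"
  have M: "N x \<le> M" if "\<bar>x\<bar> \<le> r" for x unfolding M_def by (rule v(2)) (use that in auto)
  have "M \<ge> 0" unfolding M_def N_def by simp
  have b2: "\<bar>E2 x\<bar> \<le> (K * M) * \<bar>x\<bar>" if "\<bar>x\<bar> \<le> r" for x
  proof (rule theta_growth[OF E2 _ init(3) that])
    fix y assume y: "\<bar>y\<bar> \<le> r"
    have "\<bar>c2 y\<bar> \<le> K * \<bar>y\<bar> * N y" using c2[OF y] unfolding N_def .
    also have "\<dots> \<le> K * \<bar>y\<bar> * M" using M[OF y] K by (intro mult_left_mono) auto
    finally show "\<bar>c2 y\<bar> \<le> K * M * \<bar>y\<bar>" by (simp add: mult_ac)
  qed
  have b1: "\<bar>E1 x\<bar> \<le> (L * (K * M)) * \<bar>x\<bar>" if "\<bar>x\<bar> \<le> r" for x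
  proof (rule theta_growth[OF E1 _ init(2) that])
    fix y assume y: "\<bar>y\<bar> \<le> r"
    show "\<bar>c1 y\<bar> \<le> L * (K * M) * \<bar>y\<bar>"
      using order_trans[OF c1[OF y] mult_left_mono[OF b2[OF y] L]] by (simp add: mult_ac)
  qed
  have b0: "\<bar>E0 x\<bar> \<le> (L * (L * (K * M))) * \<bar>x\<bar>" if "\<bar>x\<bar> \<le> r" for x
  proof (rule theta_growth[OF E0 _ init(1) that])
    fix y assume y: "\<bar>y\<bar> \<le> r"
    show "\<bar>c0 y\<bar> \<le> L * (L * (K * M)) * \<bar>y\<bar>"
      using order_trans[OF c0[OF y] mult_left_mono[OF b1[OF y] L]] by (simp add: mult_ac)
  qed
  have vr: "\<bar>v\<bar> \<le> r" using v(1) by auto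
  have "M \<le> ((L\<^sup>2 + L + 1) * K * M) * \<bar>v\<bar>"
    using b0[OF vr] b1[OF vr] b2[OF vr] unfolding M_def N_def
    by (simp add: power2_eq_square algebra_simps)
  also have "\<dots> \<le> ((L\<^sup>2 + L + 1) * K * M) * r"
    using vr L K \<open>M \<ge> 0\<close> by (intro mult_left_mono) auto
  finally have "M * (1 - (L\<^sup>2 + L + 1) * K * r) \<le> 0" by (simp add: algebra_simps)
  then have "M \<le> 0" using small by (simp add: mult_le_0_iff)
  then have "N u \<le> 0" using M[OF u] by simp
  then show ?thesis unfolding N_def by auto
qed

section \<open>Jets of hypergeometric series\<close>

text \<open>The iterated Euler derivatives are defined through formal power series, where they multiply the
$n$-th coefficient by $n^k$.\<close>

definition theta_hyp :: "nat \<Rightarrow> real \<Rightarrow> real \<Rightarrow> real \<Rightarrow> real \<Rightarrow> real" where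
  "theta_hyp k a b c = eval_fps ((fps_XD ^^ k) (fps_hypergeo [a, b, c] [1, 1] 1))"

lemma theta_hyp_0: "theta_hyp 0 a b c = hyp_3F2 a b c 1 1"
  by (simp add: theta_hyp_def hyp_3F2_def fun_eq_iff)

lemma theta_hyp_at_0: "theta_hyp k a b c 0 = (if k = 0 then 1 else 0)"
  by (simp add: theta_hyp_def eval_fps_at_0 fps_mult_fps_XD_shift)

text \<open>For a parameter in $(0,1]$ the Pochhammer symbol is at most $(1)_n = n!$, factor by factor.\<close>

lemma hypergeo_coeff_le_1:
  assumes "0 < a" "a \<le> 1" "0 < b" "b \<le> 1" "0 < c" "c \<le> (1::real)"
  shows "\<bar>fps_nth (fps_hypergeo [a, b, c] [1, 1] 1) n\<bar> \<le> 1"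
proof -
  have p: "0 \<le> pochhammer x n / fact n \<and> pochhammer x n / fact n \<le> 1"
    if "0 < x" "x \<le> 1" for x :: real
  proof -
    have "pochhammer x n \<le> pochhammer 1 n"
      unfolding pochhammer_prod using that by (intro prod_mono) auto
    moreover have "0 \<le> pochhammer x n" using that by (intro less_imp_le pochhammer_pos)
    ultimately show ?thesis by (simp add: pochhammer_fact[symmetric])
  qed
  have eq: "fps_nth (fps_hypergeo [a, b, c] [1, 1] 1) n
      = (pochhammer a n / fact n) * (pochhammer b n / fact n) * (pochhammer c n / fact n)"
    by (simp add: pochhammer_fact[symmetric])
  show ?thesis unfolding eq abs_mult using p[OF assms(1,2)] p[OF assms(3,4)] p[OF assms(5,6)]
    by (intro mult_le_one mult_nonneg_nonneg) (simp_all only: abs_of_nonneg abs_ge_zero)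
qed

lemma conv_radius_hypergeo:
  assumes "0 < a" "a \<le> 1" "0 < b" "b \<le> 1" "0 < c" "c \<le> (1::real)"
  shows "fps_conv_radius ((fps_XD ^^ k) (fps_hypergeo [a, b, c] [1, 1] 1)) \<ge> 1"
proof (induction k)
  case 0
  have "fps_conv_radius (fps_hypergeo [a, b, c] [1, 1] 1) \<ge> ereal 1"
    unfolding fps_conv_radius_def
  proof (rule conv_radius_geI_ex)
    fix r :: real assume r: "0 < r" "ereal r < ereal 1"
    have "summable (\<lambda>n. fps_nth (fps_hypergeo [a, b, c] [1, 1] 1) n * r ^ n)"
    proof (rule summable_comparison_test)
      show "summable (\<lambda>n. r ^ n)" using r by (intro summable_geometric) auto
      show "\<exists>N. \<forall>n\<ge>N. norm (fps_nth (fps_hypergeo [a, b, c] [1, 1] 1) n * r ^ n) \<le> r ^ n"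
        using hypergeo_coeff_le_1[OF assms] r
        by (auto simp: abs_mult simp del: fps_hypergeo_nth intro!: mult_left_le_one_le)
    qed
    then show "\<exists>z. norm z = r \<and> summable (\<lambda>n. fps_nth (fps_hypergeo [a, b, c] [1, 1] 1) n * z ^ n)"
      using r by (intro exI[of _ r]) auto
  qed
  then show ?case by (simp add: one_ereal_def)
next
  case (Suc k)
  let ?f = "(fps_XD ^^ k) (fps_hypergeo [a, b, c] [1, 1] (1::real))"
  have "fps_conv_radius ?f \<le> fps_conv_radius (fps_deriv ?f)" by (rule fps_conv_radius_deriv)
  also have "\<dots> \<le> fps_conv_radius (fps_X * fps_deriv ?f)"
    using fps_conv_radius_mult[of fps_X "fps_deriv ?f"] by (simp add: min_def)
  also have "fps_X * fps_deriv ?f = (fps_XD ^^ Suc k) (fps_hypergeo [a, b, c] [1, 1] 1)"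
    by (simp add: fps_XD_def)
  finally show ?case using Suc.IH by (rule order_trans[rotated])
qed

lemma norm_less_conv_radius_hypergeo:
  fixes x :: real
  assumes "0 < a" "a \<le> 1" "0 < b" "b \<le> 1" "0 < c" "c \<le> (1::real)" "\<bar>x\<bar> < 1"
  shows "ereal (norm x) < fps_conv_radius ((fps_XD ^^ k) (fps_hypergeo [a, b, c] [1, 1] 1))"
proof -
  have "ereal (norm x) < 1" using assms(7) by (simp add: one_ereal_def)
  then show ?thesis using conv_radius_hypergeo[OF assms(1-6)] by (rule order_less_le_trans)
qed

lemma has_theta_deriv_hyp:
  assumes "0 < a" "a \<le> 1" "0 < b" "b \<le> 1" "0 < c" "c \<le> (1::real)" "\<bar>x\<bar> < 1"
  shows "has_theta_deriv (theta_hyp k a b c) (theta_hyp (Suc k) a b c x) x"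
proof -
  define f where "f = (fps_XD ^^ k) (fps_hypergeo [a, b, c] [1, 1] (1::real))"
  have x: "ereal (norm x) < fps_conv_radius f"
    unfolding f_def by (rule norm_less_conv_radius_hypergeo[OF assms])
  then have x': "ereal (norm x) < fps_conv_radius (fps_deriv f)"
    using fps_conv_radius_deriv by (rule order_less_le_trans)
  have "eval_fps (fps_XD f) x = x * eval_fps (fps_deriv f) x"
    using x' by (simp add: fps_XD_def eval_fps_mult)
  moreover have "theta_hyp k a b c = eval_fps f" "theta_hyp (Suc k) a b c = eval_fps (fps_XD f)"
    unfolding theta_hyp_def f_def by simp_all
  moreover have "(eval_fps f has_real_derivative eval_fps (fps_deriv f) x) (at x)"
    by (rule has_field_derivative_eval_fps[OF x])
  ultimately show ?thesis by (auto intro: has_theta_derivI)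
qed

text \<open>This is the coefficient recursion $(n+1)^3 q_{n+1} = (n+a)(n+b)(n+c)\,q_n$, summed against $x^{n+1}$.\<close>

lemma theta_hyp_ode:
  assumes "0 < a" "a \<le> 1" "0 < b" "b \<le> 1" "0 < c" "c \<le> (1::real)" "\<bar>x\<bar> < 1"
  shows "(1 - x) * theta_hyp 3 a b c x = x * ((a + b + c) * theta_hyp 2 a b c x
    + (a * b + a * c + b * c) * theta_hyp 1 a b c x + a * b * c * theta_hyp 0 a b c x)"
proof -
  define q where "q n = fps_nth (fps_hypergeo [a, b, c] [1, 1] (1::real)) n" for n
  have s: "(\<lambda>n. real n ^ k * q n * x ^ n) sums theta_hyp k a b c x" for k
    using sums_eval_fps[OF norm_less_conv_radius_hypergeo[OF assms, of k]]
    unfolding theta_hyp_def q_def by (simp only: fps_mult_fps_XD_shift fps_nth_Abs_fps)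
  have rec: "real (Suc n) ^ 3 * q (Suc n)
      = (real n ^ 3 + (a + b + c) * real n ^ 2 + (a * b + a * c + b * c) * real n ^ 1
          + a * b * c * real n ^ 0) * q n" for n
  proof -
    have "q (Suc n) = (a + real n) * (b + real n) * (c + real n) / real (Suc n) ^ 3 * q n"
      unfolding q_def fps_hypergeo_rec[of _ _ _ n] by (simp add: power3_eq_cube)
    then have "real (Suc n) ^ 3 * q (Suc n) = (a + real n) * (b + real n) * (c + real n) * q n"
      by simp
    then show ?thesis by (simp add: power3_eq_cube power2_eq_square algebra_simps)
  qed
  define v where "v = x * (theta_hyp 3 a b c x + (a + b + c) * theta_hyp 2 a b c x
       + (a * b + a * c + b * c) * theta_hyp 1 a b c x + a * b * c * theta_hyp 0 a b c x)"
  have "(\<lambda>n. real (Suc n) ^ 3 * q (Suc n) * x ^ Suc n) sums theta_hyp 3 a b c x"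
    using s[of 3] by (subst sums_Suc_iff) simp
  moreover have "(\<lambda>n. x * (real n ^ 3 * q n * x ^ n + (a + b + c) * (real n ^ 2 * q n * x ^ n)
      + (a * b + a * c + b * c) * (real n ^ 1 * q n * x ^ n)
      + a * b * c * (real n ^ 0 * q n * x ^ n))) sums v"
    unfolding v_def by (intro sums_mult sums_add s)
  moreover have "(\<lambda>n. real (Suc n) ^ 3 * q (Suc n) * x ^ Suc n) =
      (\<lambda>n. x * (real n ^ 3 * q n * x ^ n + (a + b + c) * (real n ^ 2 * q n * x ^ n)
      + (a * b + a * c + b * c) * (real n ^ 1 * q n * x ^ n)
      + a * b * c * (real n ^ 0 * q n * x ^ n)))"
    by (rule ext, unfold rec power_Suc) (simp only: algebra_simps)
  ultimately have "theta_hyp 3 a b c x = v" by (simp only: sums_unique2)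
  then show ?thesis by (simp add: v_def algebra_simps)
qed

section \<open>Jets of the two series in the cusp coordinate\<close>

text \<open>With $u = 1/t$ these are the argument of $F_2$, the argument of $F_1$, and the quotient $F_1/F_2$ of
the two weight-two forms, which the transformation claims to be this algebraic function.\<close>

definition level2_arg :: "real \<Rightarrow> real" where "level2_arg u = 256 * u / (1 + 64 * u) ^ 2"
definition level1_arg :: "real \<Rightarrow> real" where "level1_arg u = 1728 * u / (1 + 256 * u) ^ 3"
definition level_factor :: "real \<Rightarrow> real" where "level_factor u = sqrt ((1 + 256 * u) / (1 + 64 * u))"

text \<open>The rational functions below are products of powers of affine functions of $u$, for which logarithmic
derivatives are additive; the derivative of a value $f(u)$ is therefore written as $f(u)\cdot a$.\<close>

lemma has_theta_deriv_log_mult: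
  assumes "has_theta_deriv f (f u * a) u" "has_theta_deriv g (g u * b) u"
  shows "has_theta_deriv (\<lambda>x. f x * g x) (f u * g u * (a + b)) u"
  using has_theta_deriv_mult[OF assms] by (simp add: algebra_simps)

lemma has_theta_deriv_log_inverse:
  assumes "has_theta_deriv d c u" "d u \<noteq> 0"
  shows "has_theta_deriv (\<lambda>x. 1 / d x) (1 / d u * (- c / d u)) u"
proof -
  obtain D where D: "(d has_real_derivative D) (at u)" "u * D = c"
    using assms(1) unfolding has_theta_deriv_def by blast
  have "((\<lambda>x. 1 / d x) has_real_derivative - D / (d u * d u)) (at u)"
    using D(1) assms(2) by (auto intro!: derivative_eq_intros)
  moreover have "u * (- D / (d u * d u)) = 1 / d u * (- c / d u)"
    by (simp add: D(2)[symmetric])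
  ultimately show ?thesis by (rule has_theta_derivI)
qed

lemma has_theta_deriv_log_sqrt:
  assumes "has_theta_deriv f (f u * a) u" "f u > 0"
  shows "has_theta_deriv (\<lambda>x. sqrt (f x)) (sqrt (f u) * (a / 2)) u"
proof -
  obtain D where D: "(f has_real_derivative D) (at u)" "u * D = f u * a"
    using assms(1) unfolding has_theta_deriv_def by blast
  have "u * (inverse (sqrt (f u)) / 2 * D) = inverse (sqrt (f u)) / 2 * (sqrt (f u) * sqrt (f u) * a)"
    using D(2) assms(2) by simp
  also have "\<dots> = sqrt (f u) * (a / 2)" using assms(2) by (simp add: field_simps)
  finally show ?thesis
    by (intro has_theta_derivI[OF DERIV_chain2[OF DERIV_real_sqrt[OF assms(2)] D(1)]])
qed

lemma has_theta_deriv_affine: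
  "has_theta_deriv (\<lambda>x. 1 + k * x) (k * u) u"  "has_theta_deriv (\<lambda>x. 1 - k * x) (- (k * u)) u"
  "has_theta_deriv (\<lambda>x. k * x) (k * u * 1) u"
  by (auto intro!: has_theta_derivI derivative_eq_intros)

lemma theta_level2_arg:
  assumes "1 + 64 * u \<noteq> 0"
  shows "has_theta_deriv level2_arg (level2_arg u * ((1 - 64 * u) / (1 + 64 * u))) u"
proof -
  note d = has_theta_deriv_log_inverse[OF has_theta_deriv_affine(1) assms]
  have "1 + - (64 * u) / (1 + 64 * u) + - (64 * u) / (1 + 64 * u) = (1 - 64 * u) / (1 + 64 * u)"
    using assms by (simp add: divide_simps)
  then show ?thesis
    using has_theta_deriv_log_mult[OF has_theta_deriv_log_mult[OF has_theta_deriv_affine(3)[of 256] d] d]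
    unfolding level2_arg_def[abs_def] by (simp add: power2_eq_square)
qed

lemma theta_level1_arg:
  assumes "1 + 256 * u \<noteq> 0"
  shows "has_theta_deriv level1_arg (level1_arg u * ((1 - 512 * u) / (1 + 256 * u))) u"
proof -
  note d = has_theta_deriv_log_inverse[OF has_theta_deriv_affine(1) assms]
  have "1 + - (256 * u) / (1 + 256 * u) + - (256 * u) / (1 + 256 * u) + - (256 * u) / (1 + 256 * u)
      = (1 - 512 * u) / (1 + 256 * u)"
    using assms by (simp add: divide_simps)
  then show ?thesis
    using has_theta_deriv_log_mult[OF has_theta_deriv_log_mult[OF
      has_theta_deriv_log_mult[OF has_theta_deriv_affine(3)[of 1728] d] d] d]
    unfolding level1_arg_def[abs_def] by (simp add: power3_eq_cube)
qed

lemma theta_level_factor: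
  assumes "1 + 256 * u > 0" "1 + 64 * u > 0"
  shows "has_theta_deriv level_factor (level_factor u * (96 * u / ((1 + 256 * u) * (1 + 64 * u)))) u"
proof -
  have n: "has_theta_deriv (\<lambda>x. 1 + 256 * x) ((1 + 256 * u) * (256 * u / (1 + 256 * u))) u"
    using has_theta_deriv_affine(1)[of 256 u] assms by simp
  have d: "has_theta_deriv (\<lambda>x. 1 / (1 + 64 * x)) (1 / (1 + 64 * u) * (- (64 * u) / (1 + 64 * u))) u"
    using assms by (intro has_theta_deriv_log_inverse has_theta_deriv_affine) auto
  have "(256 * u / (1 + 256 * u) + - (64 * u) / (1 + 64 * u)) / 2
      = 96 * u / ((1 + 256 * u) * (1 + 64 * u))"
    using assms by (simp add: divide_simps) (simp add: algebra_simps)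
  then show ?thesis
    using has_theta_deriv_log_sqrt[OF has_theta_deriv_log_mult[OF n d]] assms unfolding level_factor_def[abs_def]
    by (simp add: mult.commute[of "1 + 64 * u"])
qed

text \<open>Write $\kappa_1 = (1-512u)/(1+256u)$ and $\kappa_2 = (1-64u)/(1+64u)$ for the logarithmic derivatives of the
arguments of $F_1$ and $F_2$, and $m$ for that of the factor $\rho$ between the two series. If
$F_1 = \rho F_2$, each further jet component of $F_1$ arises from the preceding one by the operator
$\kappa_1^{-1}\theta$. On a combination $\rho\,(a F_2 + b\,\theta F_2 + c\,\theta^2 F_2)$ this operator acts through
$a' = (\theta a + m a)/\kappa_1$, $b' = (\theta b + m b + \kappa_2 a)/\kappa_1$, and so on. Starting from
$(a,b,c) = (1,0,0)$, the definitions below list the rows that result. The common denominators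
$(1+64u)(1-512u)$ and $(1+64u)^2(1-512u)^3$ are kept in the factors, so that the remaining
coefficients are polynomials. Zero coefficients are written out in the rows, which gives all three the shape
to which \<open>theta_combination\<close> applies.\<close>

definition row1_factor :: "real \<Rightarrow> real" where
  "row1_factor u = level_factor u * (1 / (1 + 64 * u)) * (1 / (1 - 512 * u))"

definition row2_factor :: "real \<Rightarrow> real" where
  "row2_factor u = row1_factor u * (1 / (1 + 64 * u)) * (1 / (1 - 512 * u)) * (1 / (1 - 512 * u))"

definition row2_0 :: "real \<Rightarrow> real" where
  "row2_0 u = 96 * u + 33792 * u ^ 2 - 1572864 * u ^ 3 + 805306368 * u ^ 4"

definition row2_1 :: "real \<Rightarrow> real" where
  "row2_1 u = (1 + 256 * u) * (832 * u - 77824 * u ^ 2 + 19922944 * u ^ 3)"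

definition row2_2 :: "real \<Rightarrow> real" where
  "row2_2 u = (1 + 256 * u) ^ 2 * (1 - 64 * u) ^ 2 * (1 - 512 * u)"

definition level2_jet :: "nat \<Rightarrow> real \<Rightarrow> real" where
  "level2_jet k u = theta_hyp k (1/4) (1/2) (3/4) (level2_arg u)"

definition transferred_jet0 :: "real \<Rightarrow> real" where
  "transferred_jet0 u = level_factor u *
    (1 * level2_jet 0 u + 0 * level2_jet 1 u + 0 * level2_jet 2 u)"

definition transferred_jet1 :: "real \<Rightarrow> real" where
  "transferred_jet1 u = row1_factor u *
    (96 * u * level2_jet 0 u + (1 + 256 * u) * (1 - 64 * u) * level2_jet 1 u + 0 * level2_jet 2 u)"

definition transferred_jet2 :: "real \<Rightarrow> real" where
  "transferred_jet2 u = row2_factor u *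
    (row2_0 u * level2_jet 0 u + row2_1 u * level2_jet 1 u + row2_2 u * level2_jet 2 u)"

text \<open>The product rule for one row of such a system: \<open>l\<close> and \<open>k\<close> are the logarithmic derivatives of the common
factor and of the inner argument, and \<open>h'\<close> is the value of the third derivative, which the
differential equation will supply.\<close>

lemma theta_combination:
  assumes "has_theta_deriv s (s u * l) u"
    and "has_theta_deriv A a u" "has_theta_deriv B b u" "has_theta_deriv C c u"
    and "has_theta_deriv f (k * g u) u" "has_theta_deriv g (k * h u) u" "has_theta_deriv h (k * h') u"
  shows "has_theta_deriv (\<lambda>x. s x * (A x * f x + B x * g x + C x * h x))
    (s u * ((l * A u + a) * f u + (l * B u + b + k * A u) * g u + (l * C u + c + k * B u) * h u
       + k * C u * h')) u"
proof -
  note d = has_theta_deriv_mult[OF assms(1) has_theta_deriv_add[OF has_theta_deriv_add[OF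
    has_theta_deriv_mult[OF assms(2,5)] has_theta_deriv_mult[OF assms(3,6)]]
    has_theta_deriv_mult[OF assms(4,7)]]]
  show ?thesis
    by (rule iffD1[OF _ d], rule arg_cong[where f = "\<lambda>c. has_theta_deriv _ c u"])
      (simp add: algebra_simps)
qed

lemma args_in_unit_interval:
  assumes "\<bar>u\<bar> \<le> 1 / 10 ^ 6"
  shows "\<bar>level2_arg u\<bar> < 1" "\<bar>level1_arg u\<bar> < 1"
proof -
  have "(1 - 64 / 10 ^ 6) ^ 2 \<le> (1 + 64 * u) ^ 2" using assms by (intro power_mono) auto
  moreover have "256 * \<bar>u\<bar> < (1 - 64 / 10 ^ 6) ^ 2" using assms by (simp add: power2_eq_square)
  ultimately show "\<bar>level2_arg u\<bar> < 1" unfolding level2_arg_def by (simp add: abs_mult divide_simps)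
  have "(1 - 256 / 10 ^ 6) ^ 3 \<le> (1 + 256 * u) ^ 3" using assms by (intro power_mono) auto
  moreover have "1728 * \<bar>u\<bar> < (1 - 256 / 10 ^ 6) ^ 3" using assms by (simp add: power3_eq_cube)
  ultimately have "1728 * \<bar>u\<bar> < (1 + 256 * u) ^ 3" by linarith
  moreover from this have "0 < (1 + 256 * u) ^ 3" by linarith
  ultimately show "\<bar>level1_arg u\<bar> < 1" unfolding level1_arg_def by (simp add: abs_mult divide_simps)
qed

lemma theta_hyp_compose_level2_arg:
  assumes "\<bar>u\<bar> \<le> 1 / 10 ^ 6"
  shows "has_theta_deriv (\<lambda>u. theta_hyp k (1/4) (1/2) (3/4) (level2_arg u))
     ((1 - 64 * u) / (1 + 64 * u) * theta_hyp (Suc k) (1/4) (1/2) (3/4) (level2_arg u)) u"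
  by (rule has_theta_deriv_compose[OF theta_level2_arg has_theta_deriv_hyp])
    (use assms args_in_unit_interval[OF assms] in auto)

text \<open>The last component uses the differential equation of $F_2$ together with
$1 - \xi = (1-64u)^2/(1+64u)^2$.\<close>

lemma theta_level2_jet:
  assumes "\<bar>u\<bar> \<le> 1 / 10 ^ 6"
  shows "has_theta_deriv (level2_jet 0) ((1 - 64 * u) / (1 + 64 * u) * level2_jet 1 u) u"
    "has_theta_deriv (level2_jet 1) ((1 - 64 * u) / (1 + 64 * u) * level2_jet 2 u) u"
    "has_theta_deriv (level2_jet 2) ((1 - 64 * u) / (1 + 64 * u) * (256 * u / (1 - 64 * u) ^ 2 *
        (3 / 2 * level2_jet 2 u + 11 / 16 * level2_jet 1 u + 3 / 32 * level2_jet 0 u))) u"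
proof -
  show "has_theta_deriv (level2_jet 0) ((1 - 64 * u) / (1 + 64 * u) * level2_jet 1 u) u"
    "has_theta_deriv (level2_jet 1) ((1 - 64 * u) / (1 + 64 * u) * level2_jet 2 u) u"
    using theta_hyp_compose_level2_arg[OF assms, of 0] theta_hyp_compose_level2_arg[OF assms, of 1]
    unfolding level2_jet_def by (simp_all add: numeral_2_eq_2)
  have nz: "1 + 64 * u \<noteq> 0" "1 - 64 * u \<noteq> 0" using assms by auto
  let ?r = "3 / 2 * level2_jet 2 u + 11 / 16 * level2_jet 1 u + 3 / 32 * level2_jet 0 u"
  have "(1 - level2_arg u) * level2_jet 3 u = level2_arg u * ?r"
    using theta_hyp_ode[of "1/4" "1/2" "3/4" "level2_arg u"] args_in_unit_interval[OF assms]
    unfolding level2_jet_def by simp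
  moreover have "1 - level2_arg u = (1 - 64 * u) ^ 2 / (1 + 64 * u) ^ 2"
    unfolding level2_arg_def using nz by (simp add: divide_simps) algebra
  ultimately have "(1 - 64 * u) ^ 2 * level2_jet 3 u = 256 * u * ?r"
    using nz unfolding level2_arg_def by (simp add: divide_simps)
  then have "level2_jet 3 u = 256 * u / (1 - 64 * u) ^ 2 * ?r"
    using nz by (simp add: divide_simps mult.commute)
  then show "has_theta_deriv (level2_jet 2) ((1 - 64 * u) / (1 + 64 * u) * (256 * u / (1 - 64 * u) ^ 2 * ?r)) u"
    using theta_hyp_compose_level2_arg[OF assms, of 2] unfolding level2_jet_def by (simp add: numeral_3_eq_3)
qed

lemma log_inverse_1_plus_64u: "1 + 64 * u \<noteq> 0 \<Longrightarrow>
  has_theta_deriv (\<lambda>x. 1 / (1 + 64 * x)) (1 / (1 + 64 * u) * (- (64 * u) / (1 + 64 * u))) u"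
  by (intro has_theta_deriv_log_inverse has_theta_deriv_affine)

lemma log_inverse_1_minus_512u: "1 - 512 * u \<noteq> 0 \<Longrightarrow>
  has_theta_deriv (\<lambda>x. 1 / (1 - 512 * x)) (1 / (1 - 512 * u) * (- (- (512 * u)) / (1 - 512 * u))) u"
  by (intro has_theta_deriv_log_inverse has_theta_deriv_affine)

lemma has_theta_deriv_const: "has_theta_deriv (\<lambda>_. c) 0 u"
  by (rule has_theta_derivI[OF DERIV_const]) simp

lemma theta_transferred_jet0:
  assumes u: "\<bar>u\<bar> \<le> 1 / 10 ^ 6"
  shows "has_theta_deriv transferred_jet0 ((1 - 512 * u) / (1 + 256 * u) * transferred_jet1 u) u"
proof -
  have nz: "1 + 64 * u > 0" "1 + 256 * u > 0" "1 - 512 * u > 0" using u by auto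
  let ?l = "96 * u / ((1 + 256 * u) * (1 + 64 * u))"
  let ?k = "(1 - 64 * u) / (1 + 64 * u)"
  let ?q = "1 / ((1 + 256 * u) * (1 + 64 * u))"
  have id: "?l * 1 + 0 = ?q * (96 * u)" "?l * 0 + 0 + ?k * 1 = ?q * ((1 + 256 * u) * (1 - 64 * u))"
    using nz by (simp_all add: divide_simps)
  have "(1 - 512 * u) / (1 + 256 * u) * row1_factor u = level_factor u * ?q"
    unfolding row1_factor_def using nz by (simp add: divide_simps)
  then have eq: "(1 - 512 * u) / (1 + 256 * u) * (row1_factor u * x) = level_factor u * (?q * x)" for x
    by (metis mult.assoc)
  show ?thesis
    using theta_combination[OF theta_level_factor[OF nz(2,1)] has_theta_deriv_const has_theta_deriv_const
       has_theta_deriv_const theta_level2_jet[OF u], of 1 0 0]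
    unfolding transferred_jet0_def[abs_def] transferred_jet1_def eq id
    by (simp add: distrib_left mult.assoc)
qed

lemma theta_transferred_jet1:
  assumes u: "\<bar>u\<bar> \<le> 1 / 10 ^ 6"
  shows "has_theta_deriv transferred_jet1 ((1 - 512 * u) / (1 + 256 * u) * transferred_jet2 u) u"
proof -
  have nz: "1 + 64 * u \<noteq> 0" "1 + 256 * u \<noteq> 0" "1 - 512 * u \<noteq> 0"
    and pos: "1 + 64 * u > 0" "1 + 256 * u > 0" using u by auto
  define l where "l = 96 * u / ((1 + 256 * u) * (1 + 64 * u)) + - (64 * u) / (1 + 64 * u)
    + - (- (512 * u)) / (1 - 512 * u)"
  have s: "has_theta_deriv row1_factor (row1_factor u * l) u"
    unfolding row1_factor_def[abs_def] l_def
    by (intro has_theta_deriv_log_mult theta_level_factor log_inverse_1_plus_64u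
        log_inverse_1_minus_512u pos nz)
  have p1: "has_theta_deriv (\<lambda>u. 96 * u) (96 * u) u"
    by (rule has_theta_derivI) (auto intro!: derivative_eq_intros)
  have p2: "has_theta_deriv (\<lambda>u. (1 + 256 * u) * (1 - 64 * u))
      (u * (256 * (1 - 64 * u) - 64 * (1 + 256 * u))) u"
    by (rule has_theta_derivI) (auto intro!: derivative_eq_intros)
  let ?k = "(1 - 64 * u) / (1 + 64 * u)"
  define q where "q = 1 / ((1 + 256 * u) * (1 + 64 * u) * (1 - 512 * u))"
  have id0: "l * (96 * u) + 96 * u = q * row2_0 u"
    unfolding l_def q_def row2_0_def using nz by (simp add: divide_simps) algebra
  have id1: "l * ((1 + 256 * u) * (1 - 64 * u)) + u * (256 * (1 - 64 * u) - 64 * (1 + 256 * u))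
      + ?k * (96 * u) = q * row2_1 u"
    unfolding l_def q_def row2_1_def using nz by (simp add: divide_simps) algebra
  have id2: "l * 0 + 0 + ?k * ((1 + 256 * u) * (1 - 64 * u)) = q * row2_2 u"
    unfolding q_def row2_2_def using nz by (simp add: divide_simps) algebra
  have "(1 - 512 * u) / (1 + 256 * u) * row2_factor u = row1_factor u * q"
    unfolding row2_factor_def q_def using nz by (simp add: divide_simps)
  then have eq: "(1 - 512 * u) / (1 + 256 * u) * (row2_factor u * x) = row1_factor u * (q * x)" for x
    by (metis mult.assoc)
  show ?thesis
    using theta_combination[OF s p1 p2 has_theta_deriv_const theta_level2_jet[OF u], of 0]
    unfolding transferred_jet1_def[abs_def] transferred_jet2_def eq id0 id1 id2
    by (simp add: distrib_left mult.assoc)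
qed

text \<open>The substance of the transformation: the transferred jet closes up under the equation of $F_1$. After
division by the common factor, the claim splits into three identities of rational functions, one
for each of $F_2$, $\theta F_2$ and $\theta^2 F_2$.\<close>

lemma theta_transferred_jet2:
  assumes u: "\<bar>u\<bar> \<le> 1 / 10 ^ 6"
  shows "has_theta_deriv transferred_jet2 (1728 * u / ((1 + 256 * u) * (1 + 64 * u) * (1 - 512 * u)) *
     (3 / 2 * transferred_jet2 u + 23 / 36 * transferred_jet1 u + 5 / 72 * transferred_jet0 u)) u"
proof -
  have nz: "1 + 64 * u \<noteq> 0" "1 + 256 * u \<noteq> 0" "1 - 512 * u \<noteq> 0" "1 - 64 * u \<noteq> 0"
    and pos: "1 + 64 * u > 0" "1 + 256 * u > 0" using u by auto
  define l where "l = 96 * u / ((1 + 256 * u) * (1 + 64 * u)) + - (64 * u) / (1 + 64 * u)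
    + - (- (512 * u)) / (1 - 512 * u) + - (64 * u) / (1 + 64 * u)
    + - (- (512 * u)) / (1 - 512 * u) + - (- (512 * u)) / (1 - 512 * u)"
  have s: "has_theta_deriv row2_factor (row2_factor u * l) u"
    unfolding row2_factor_def[abs_def] row1_factor_def[abs_def] l_def
    by (intro has_theta_deriv_log_mult theta_level_factor log_inverse_1_plus_64u
        log_inverse_1_minus_512u pos nz)
  define a where "a = u * (96 + 67584 * u - 4718592 * u ^ 2 + 3221225472 * u ^ 3)"
  define b where "b = u * (256 * (832 * u - 77824 * u ^ 2 + 19922944 * u ^ 3)
     + (1 + 256 * u) * (832 - 155648 * u + 59768832 * u ^ 2))"
  define c where "c = u * (512 * (1 + 256 * u) * (1 - 64 * u) ^ 2 * (1 - 512 * u)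
     - 128 * (1 + 256 * u) ^ 2 * (1 - 64 * u) * (1 - 512 * u)
     - 512 * (1 + 256 * u) ^ 2 * (1 - 64 * u) ^ 2)"
  have pa: "has_theta_deriv row2_0 a u" unfolding row2_0_def[abs_def] a_def
    by (rule has_theta_derivI[OF _ refl]) (rule derivative_eq_intros refl | simp)+
  have pb: "has_theta_deriv row2_1 b u" unfolding row2_1_def[abs_def] b_def
    by (rule has_theta_derivI[OF _ refl]) (rule derivative_eq_intros refl | simp)+
  have pc: "has_theta_deriv row2_2 c u" unfolding row2_2_def[abs_def] c_def
    by (rule has_theta_derivI[OF _ refl]) ((rule derivative_eq_intros refl | simp)+, algebra)
  let ?k = "(1 - 64 * u) / (1 + 64 * u)" and ?x = "256 * u / (1 - 64 * u) ^ 2"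
  define q where "q = 1728 * u / ((1 + 256 * u) * (1 + 64 * u) * (1 - 512 * u))"
  have id0: "l * row2_0 u + a + ?k * row2_2 u * ?x * (3 / 32) = q * (3 / 2 * row2_0 u
      + 23 / 36 * (96 * u) * ((1 + 64 * u) * (1 - 512 * u) ^ 2)
      + 5 / 72 * ((1 + 64 * u) ^ 2 * (1 - 512 * u) ^ 3))"
    unfolding l_def q_def row2_0_def row2_2_def a_def using nz
    by (simp add: divide_simps) algebra
  have id1: "l * row2_1 u + b + ?k * row2_0 u + ?k * row2_2 u * ?x * (11 / 16) = q * (3 / 2 * row2_1 u
      + 23 / 36 * ((1 + 256 * u) * (1 - 64 * u)) * ((1 + 64 * u) * (1 - 512 * u) ^ 2))"
    unfolding l_def q_def row2_0_def row2_1_def row2_2_def b_def using nz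
    by (simp add: divide_simps) algebra
  have id2: "l * row2_2 u + c + ?k * row2_1 u + ?k * row2_2 u * ?x * (3 / 2) = q * (3 / 2 * row2_2 u)"
    unfolding l_def q_def row2_1_def row2_2_def c_def using nz
    by (simp add: divide_simps) algebra
  have s1: "row1_factor u = row2_factor u * ((1 + 64 * u) * (1 - 512 * u) ^ 2)"
    unfolding row2_factor_def using nz by (simp add: power2_eq_square)
  have s0: "level_factor u = row2_factor u * ((1 + 64 * u) ^ 2 * (1 - 512 * u) ^ 3)"
    unfolding row2_factor_def row1_factor_def using nz by (simp add: power2_eq_square power3_eq_cube)
  \<comment> \<open>First collect the coefficients of $F_2$, $\theta F_2$, $\theta^2 F_2$, to which \<open>id0\<close>, \<open>id1\<close> and
    \<open>id2\<close> apply; then reassemble the outcome into the three rows.\<close>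
  have regroup: "S * ((lA + a') * f + (lB + b' + kA) * g + (lC + c' + kB) * h
         + kC * (x * (3 / 2 * h + 11 / 16 * g + 3 / 32 * f)))
     = S * ((lA + a' + kC * x * (3 / 32)) * f + (lB + b' + kA + kC * x * (11 / 16)) * g
         + (lC + c' + kB + kC * x * (3 / 2)) * h)" for S lA a' lB b' kA lC c' kB kC x f g h :: real
    by (simp add: algebra_simps)
  have collect: "S * (q * (3 / 2 * A + 23 / 36 * A1 * d + 5 / 72 * e) * f + q * (3 / 2 * B + 23 / 36 * B1 * d) * g
        + q * (3 / 2 * C) * h)
     = q * (3 / 2 * (S * (A * f + B * g + C * h)) + 23 / 36 * (S * d * (A1 * f + B1 * g + 0 * h))
       + 5 / 72 * (S * e * (1 * f + 0 * g + 0 * h)))"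
    for S A A1 B B1 C d e f g h :: real
    by (simp add: algebra_simps)
  show ?thesis
    using theta_combination[OF s pa pb pc theta_level2_jet[OF u]]
    unfolding regroup id0 id1 id2 collect
    unfolding transferred_jet2_def[symmetric] s1[symmetric] s0[symmetric]
      transferred_jet1_def[symmetric] transferred_jet0_def[symmetric] q_def
    unfolding transferred_jet2_def[abs_def, symmetric] .
qed

section \<open>The transformation from level two to level one\<close>

definition level1_jet :: "nat \<Rightarrow> real \<Rightarrow> real" where
  "level1_jet k u = theta_hyp k (1/6) (1/2) (5/6) (level1_arg u)"

text \<open>The last component uses the differential equation of $F_1$ together with
$1 - z = (1+64u)(1-512u)^2/(1+256u)^3$.\<close>

lemma theta_level1_jet:
  assumes "\<bar>u\<bar> \<le> 1 / 10 ^ 6"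
  shows "has_theta_deriv (level1_jet 0) ((1 - 512 * u) / (1 + 256 * u) * level1_jet 1 u) u"
    "has_theta_deriv (level1_jet 1) ((1 - 512 * u) / (1 + 256 * u) * level1_jet 2 u) u"
    "has_theta_deriv (level1_jet 2) (1728 * u / ((1 + 256 * u) * (1 + 64 * u) * (1 - 512 * u)) *
        (3 / 2 * level1_jet 2 u + 23 / 36 * level1_jet 1 u + 5 / 72 * level1_jet 0 u)) u"
proof -
  have nz: "1 + 64 * u \<noteq> 0" "1 + 256 * u \<noteq> 0" "1 - 512 * u \<noteq> 0" using assms by auto
  have d: "has_theta_deriv (level1_jet k) ((1 - 512 * u) / (1 + 256 * u)
      * theta_hyp (Suc k) (1/6) (1/2) (5/6) (level1_arg u)) u" for k
    unfolding level1_jet_def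
    by (rule has_theta_deriv_compose[OF theta_level1_arg has_theta_deriv_hyp])
      (use nz args_in_unit_interval[OF assms] in auto)
  show "has_theta_deriv (level1_jet 0) ((1 - 512 * u) / (1 + 256 * u) * level1_jet 1 u) u"
    "has_theta_deriv (level1_jet 1) ((1 - 512 * u) / (1 + 256 * u) * level1_jet 2 u) u"
    using d[of 0] d[of 1] by (simp_all add: level1_jet_def numeral_2_eq_2)
  let ?r = "3 / 2 * level1_jet 2 u + 23 / 36 * level1_jet 1 u + 5 / 72 * level1_jet 0 u"
  have "(1 - level1_arg u) * level1_jet 3 u = level1_arg u * ?r"
    using theta_hyp_ode[of "1/6" "1/2" "5/6" "level1_arg u"] args_in_unit_interval[OF assms]
    unfolding level1_jet_def by simp
  moreover have "1 - level1_arg u = (1 + 64 * u) * (1 - 512 * u) ^ 2 / (1 + 256 * u) ^ 3"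
    unfolding level1_arg_def using nz by (simp add: divide_simps) algebra
  ultimately have "(1 + 64 * u) * (1 - 512 * u) ^ 2 * level1_jet 3 u = 1728 * u * ?r"
    using nz unfolding level1_arg_def by (simp add: divide_simps)
  then have "level1_jet 3 u = 1728 * u / ((1 + 64 * u) * (1 - 512 * u) ^ 2) * ?r"
    using nz by (simp add: divide_simps mult.commute)
  moreover have "(1 - 512 * u) / (1 + 256 * u) * (1728 * u / ((1 + 64 * u) * (1 - 512 * u) ^ 2) * r)
      = 1728 * u / ((1 + 256 * u) * (1 + 64 * u) * (1 - 512 * u)) * r" for r
    using nz by (simp add: divide_simps) algebra
  moreover have "has_theta_deriv (level1_jet 2) ((1 - 512 * u) / (1 + 256 * u) * level1_jet 3 u) u"
    using d[of 2] by (simp add: level1_jet_def numeral_3_eq_3)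
  ultimately show "has_theta_deriv (level1_jet 2) (1728 * u / ((1 + 256 * u) * (1 + 64 * u) * (1 - 512 * u)) * ?r) u"
    by metis
qed

text \<open>The difference of the two jets solves a system to which \<open>theta_system_unique\<close> applies. On
$|u| \le 10^{-6}$ the function $\kappa_1$ is bounded by $2$, and the coefficients of the last equation by
$2700\,|u|$; the smallness condition is then $7 \cdot 2700 \cdot 10^{-6} < 1$.\<close>

lemma jets_agree:
  assumes u: "\<bar>u\<bar> \<le> 1 / 10 ^ 6"
  shows "level1_jet 0 u = transferred_jet0 u" "level1_jet 1 u = transferred_jet1 u"
proof -
  let ?k = "\<lambda>u. (1 - 512 * u) / (1 + 256 * u)"
  let ?q = "\<lambda>u. 1728 * u / ((1 + 256 * u) * (1 + 64 * u) * (1 - 512 * u))"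
  define E0 where "E0 = (\<lambda>u. level1_jet 0 u - transferred_jet0 u)"
  define E1 where "E1 = (\<lambda>u. level1_jet 1 u - transferred_jet1 u)"
  define E2 where "E2 = (\<lambda>u. level1_jet 2 u - transferred_jet2 u)"
  have "E0 u = 0 \<and> E1 u = 0 \<and> E2 u = 0"
  proof (rule theta_system_unique[of "1 / 10 ^ 6" 2 2700 E0 "\<lambda>u. ?k u * E1 u" E1
        "\<lambda>u. ?k u * E2 u" E2
        "\<lambda>u. ?q u * (3 / 2 * E2 u + 23 / 36 * E1 u + 5 / 72 * E0 u)"])
    fix x :: real assume x: "\<bar>x\<bar> \<le> 1 / 10 ^ 6"
    show "has_theta_deriv E0 (?k x * E1 x) x"
      using has_theta_deriv_diff[OF theta_level1_jet(1)[OF x] theta_transferred_jet0[OF x]]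
      unfolding E0_def E1_def by (simp only: right_diff_distrib)
    show "has_theta_deriv E1 (?k x * E2 x) x"
      using has_theta_deriv_diff[OF theta_level1_jet(2)[OF x] theta_transferred_jet1[OF x]]
      unfolding E1_def E2_def by (simp only: right_diff_distrib)
    have lin: "a * (3 / 2 * h2 + 23 / 36 * h1 + 5 / 72 * h0) - a * (3 / 2 * v2 + 23 / 36 * v1 + 5 / 72 * v0)
       = a * (3 / 2 * (h2 - v2) + 23 / 36 * (h1 - v1) + 5 / 72 * (h0 - v0))" for a h0 h1 h2 v0 v1 v2 :: real
      by algebra
    show "has_theta_deriv E2 (?q x * (3 / 2 * E2 x + 23 / 36 * E1 x + 5 / 72 * E0 x)) x"
      using has_theta_deriv_diff[OF theta_level1_jet(3)[OF x] theta_transferred_jet2[OF x]]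
      unfolding lin E0_def E1_def E2_def .
    have "1 + 256 * x > 0" "\<bar>1 - 512 * x\<bar> \<le> 2 * (1 + 256 * x)" using x unfolding abs_le_iff by auto
    then have "\<bar>?k x\<bar> \<le> 2" by (simp add: abs_divide pos_divide_le_eq)
    then show "\<bar>?k x * E1 x\<bar> \<le> 2 * \<bar>E1 x\<bar>" "\<bar>?k x * E2 x\<bar> \<le> 2 * \<bar>E2 x\<bar>"
      unfolding abs_mult by (intro mult_right_mono; simp)+
    \<comment> \<open>With the coefficient $3/2$, the largest of the three, the bound $1800$ leads to $2700$.\<close>
    have "(1 - 256 / 10 ^ 6) * (1 - 64 / 10 ^ 6) * (1 - 512 / 10 ^ 6)
        \<le> (1 + 256 * x) * (1 + 64 * x) * (1 - 512 * x)"
      using x by (intro mult_mono mult_nonneg_nonneg) (auto simp: abs_le_iff)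
    then have "1 / ((1 + 256 * x) * (1 + 64 * x) * (1 - 512 * x))
        \<le> 1 / ((1 - 256 / 10 ^ 6) * (1 - 64 / 10 ^ 6) * (1 - 512 / 10 ^ 6))"
      by (intro divide_left_mono) auto
    also have "\<dots> \<le> 1800 / 1728" by simp
    finally have d: "1 / ((1 + 256 * x) * (1 + 64 * x) * (1 - 512 * x)) \<le> 1800 / 1728" .
    have pos: "0 < (1 + 256 * x) * (1 + 64 * x) * (1 - 512 * x)" using x by simp
    have "\<bar>?q x\<bar> = 1728 * \<bar>x\<bar> * (1 / ((1 + 256 * x) * (1 + 64 * x) * (1 - 512 * x)))"
      unfolding abs_divide abs_of_pos[OF pos] by
        (simp only: abs_mult abs_numeral times_divide_eq_right mult_1_right)
    also have "\<dots> \<le> 1728 * \<bar>x\<bar> * (1800 / 1728)" by (intro mult_left_mono d) auto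
    finally have q: "\<bar>?q x\<bar> \<le> 1800 * \<bar>x\<bar>" by simp
    have "\<bar>3 / 2 * E2 x + 23 / 36 * E1 x + 5 / 72 * E0 x\<bar>
        \<le> 3 / 2 * (\<bar>E0 x\<bar> + \<bar>E1 x\<bar> + \<bar>E2 x\<bar>)" by (auto simp: abs_if)
    then have "\<bar>?q x\<bar> * \<bar>3 / 2 * E2 x + 23 / 36 * E1 x + 5 / 72 * E0 x\<bar>
        \<le> (1800 * \<bar>x\<bar>) * (3 / 2 * (\<bar>E0 x\<bar> + \<bar>E1 x\<bar> + \<bar>E2 x\<bar>))"
      by (intro mult_mono q) auto
    also have "\<dots> = 2700 * \<bar>x\<bar> * (\<bar>E0 x\<bar> + \<bar>E1 x\<bar> + \<bar>E2 x\<bar>)" by simp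
    finally show "\<bar>?q x * (3 / 2 * E2 x + 23 / 36 * E1 x + 5 / 72 * E0 x)\<bar>
        \<le> 2700 * \<bar>x\<bar> * (\<bar>E0 x\<bar> + \<bar>E1 x\<bar> + \<bar>E2 x\<bar>)"
      unfolding abs_mult[of "?q x"] .
  next
    have "level2_arg 0 = 0" "level1_arg 0 = 0" "level_factor 0 = 1"
      by (simp_all add: level2_arg_def level1_arg_def level_factor_def)
    then show "E0 0 = 0" "E1 0 = 0" "E2 0 = 0"
      by (simp_all add: E0_def E1_def E2_def level1_jet_def level2_jet_def
          transferred_jet0_def transferred_jet1_def transferred_jet2_def
          theta_hyp_at_0 row2_0_def)
  qed (use u in \<open>simp_all add: power2_eq_square\<close>)
  then show "level1_jet 0 u = transferred_jet0 u" "level1_jet 1 u = transferred_jet1 u"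
    by (simp_all add: E0_def E1_def)
qed

lemma F1_F2_theta_hyp:
  "F1 = theta_hyp 0 (1/6) (1/2) (5/6)" "F2 = theta_hyp 0 (1/4) (1/2) (3/4)"
  "\<bar>x\<bar> < 1 \<Longrightarrow> theta F1 x = theta_hyp 1 (1/6) (1/2) (5/6) x"
  "\<bar>x\<bar> < 1 \<Longrightarrow> theta F2 x = theta_hyp 1 (1/4) (1/2) (3/4) x"
proof -
  show F: "F1 = theta_hyp 0 (1/6) (1/2) (5/6)" "F2 = theta_hyp 0 (1/4) (1/2) (3/4)"
    by (simp_all add: F1_def F2_def theta_hyp_0)
  show "theta F1 x = theta_hyp 1 (1/6) (1/2) (5/6) x" "theta F2 x = theta_hyp 1 (1/4) (1/2) (3/4) x"
    if "\<bar>x\<bar> < 1" unfolding F One_nat_def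
    by (rule has_theta_deriv_imp_theta, rule has_theta_deriv_hyp; use that in simp)+
qed

text \<open>The second equation is what $\kappa_1^{-1}\theta$ makes of the first; it is the relation through which
$\theta F_2$ is eliminated in favour of $\theta F_1$.\<close>

theorem F1_F2_transformation:
  assumes u: "\<bar>u\<bar> \<le> 1 / 10 ^ 6"
  shows "F1 (level1_arg u) = level_factor u * F2 (level2_arg u)"
    "theta F1 (level1_arg u) = level_factor u / ((1 + 64 * u) * (1 - 512 * u)) *
      (96 * u * F2 (level2_arg u) + (1 + 256 * u) * (1 - 64 * u) * theta F2 (level2_arg u))"
  using jets_agree[OF u] args_in_unit_interval[OF u]
  unfolding F1_F2_theta_hyp(3)[OF args_in_unit_interval(2)[OF u]]
    F1_F2_theta_hyp(4)[OF args_in_unit_interval(1)[OF u]]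
  by (simp_all add: F1_F2_theta_hyp(1,2) level1_jet_def level2_jet_def
      transferred_jet0_def transferred_jet1_def row1_factor_def)

section \<open>The two cubic equations\<close>

text \<open>If two real roots were distinct, the third root would be real as well, and the discriminant would be the
square $\left(a^2(x-y)(x-w)(y-w)\right)^2$.\<close>

lemma cubic_root_unique:
  fixes a b c d x y :: real
  assumes a: "a \<noteq> 0"
    and disc: "18 * a * b * c * d - 4 * b ^ 3 * d + b ^ 2 * c ^ 2 - 4 * a * c ^ 3 - 27 * a ^ 2 * d ^ 2 < 0"
    and x: "a * x ^ 3 + b * x ^ 2 + c * x + d = 0"
    and y: "a * y ^ 3 + b * y ^ 2 + c * y + d = 0"
  shows "x = y"
proof (rule ccontr)
  assume ne: "x \<noteq> y"
  define w where "w = - b / a - x - y"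
  have b: "b = - a * (x + y + w)" using a by (simp add: w_def field_simps)
  have "(x - y) * (a * (x ^ 2 + x * y + y ^ 2) + b * (x + y) + c) = 0" using x y by algebra
  then have "a * (x ^ 2 + x * y + y ^ 2) + b * (x + y) + c = 0" using ne by simp
  then have c: "c = a * (x * y + x * w + y * w)" unfolding b by algebra
  have d: "d = - a * x * y * w" using x unfolding b c by algebra
  have "18 * a * b * c * d - 4 * b ^ 3 * d + b ^ 2 * c ^ 2 - 4 * a * c ^ 3 - 27 * a ^ 2 * d ^ 2
      = (a ^ 2 * (x - y) * (x - w) * (y - w)) ^ 2"
    unfolding b c d by algebra
  with disc show False by simp
qed

text \<open>The leading two terms are $x^2(x + 262537412640768768)$ and dominate at distance $1/4$ from the
zero of the linear factor, which gives the sign change.\<close>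

lemma hauptmodul_cubic_root:
  defines "P \<equiv> \<lambda>x::real. x ^ 3 + 262537412640768768 * x ^ 2 + 196608 * x + 16777216 = 0"
  shows "\<exists>!x. P x" "P x \<Longrightarrow> \<bar>x + 262537412640768768\<bar> \<le> 1 / 4"
proof -
  have "\<exists>x\<ge>- 262537412640768768 - 1 / 4. x \<le> - 262537412640768768 + 1 / 4
      \<and> x ^ 3 + 262537412640768768 * x ^ 2 + 196608 * x + 16777216 = (0::real)"
    by (rule IVT') (auto intro!: continuous_intros simp: power2_eq_square power3_eq_cube)
  then obtain t where t: "P t" "- 262537412640768768 - 1 / 4 \<le> t" "t \<le> - 262537412640768768 + 1 / 4"
    unfolding P_def by blast
  then have bound: "\<bar>t + 262537412640768768\<bar> \<le> 1 / 4" unfolding abs_le_iff by linarith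
  have uniq: "x = t" if "P x" for x
    using cubic_root_unique[of 1 262537412640768768 196608 16777216 x t] that t(1)
    unfolding P_def by simp
  show "\<exists>!x. P x" using t(1) uniq by blast
  show "P x \<Longrightarrow> \<bar>x + 262537412640768768\<bar> \<le> 1 / 4" using uniq bound by blast
qed

lemma alpha_cubic_root:
  defines "P \<equiv> \<lambda>y::real. 668649972819460401 * y ^ 3 + 50012252033677839 * y ^ 2
                 + 1467 * y - 41450311432931 = 0"
  shows "\<exists>!y. P y" "P y \<Longrightarrow> y > 0"
proof -
  have "\<exists>y\<ge>0. y \<le> 1 \<and> 668649972819460401 * y ^ 3 + 50012252033677839 * y ^ 2
                 + 1467 * y - 41450311432931 = (0::real)"
    by (rule IVT') (auto intro!: continuous_intros)
  then obtain a where a: "P a" "a \<ge> 0" unfolding P_def by auto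
  moreover have "a \<noteq> 0" using a(1) unfolding P_def by auto
  ultimately have pos: "a > 0" by simp
  have uniq: "x = a" if "P x" for x
    using cubic_root_unique[of 668649972819460401 50012252033677839 1467 "- 41450311432931" x a]
      that a(1) unfolding P_def by simp
  show "\<exists>!y. P y" using a(1) uniq by blast
  show "P y \<Longrightarrow> y > 0" using uniq pos by blast
qed

text \<open>The quotient of the right-hand side by the coefficient of \<open>y\<close> lies in $\mathbb{Q}(t)$, so it is the
root of some rational cubic; this is that cubic. After clearing denominators, the cubic form in numerator and
denominator is a polynomial of degree six in \<open>t\<close>; the explicit cofactor in the proof is the result of dividing it
by the cubic of \<open>t\<close>.\<close>

lemma alpha_cubic_of_hauptmodul_cubic:
  fixes t y :: real
  assumes t: "t ^ 3 + 262537412640768768 * t ^ 2 + 196608 * t + 16777216 = 0"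
    and nz: "t + 256 \<noteq> 0" "t + 64 \<noteq> 0"
    and y: "y * (545140134 * ((t + 256) * (t + 64)))
          = 545140134 * (96 * t) + 13591409 * ((t - 512) * (t + 64))"
  shows "668649972819460401 * y ^ 3 + 50012252033677839 * y ^ 2 + 1467 * y - 41450311432931 = 0"
proof -
  define D where "D = 545140134 * ((t + 256) * (t + 64))"
  define N where "N = 545140134 * (96 * t) + 13591409 * ((t - 512) * (t + 64))"
  have "668649972819460401 * N ^ 3 + 50012252033677839 * N ^ 2 * D + 1467 * N * D ^ 2
        - 41450311432931 * D ^ 3
      = (177396030391467741240897279 * t ^ 3 + 475251288121148830969033407744 * t ^ 2
         + 314481542238441739136646732644352 * t - 5136154721548562391761473756987392)
        * (t ^ 3 + 262537412640768768 * t ^ 2 + 196608 * t + 16777216)"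
    unfolding N_def D_def by algebra
  then have "668649972819460401 * N ^ 3 + 50012252033677839 * N ^ 2 * D + 1467 * N * D ^ 2
        - 41450311432931 * D ^ 3 = 0" using t by simp
  moreover have "N = y * D" using y unfolding N_def D_def by simp
  ultimately have "D ^ 3 * (668649972819460401 * y ^ 3 + 50012252033677839 * y ^ 2 + 1467 * y
        - 41450311432931) = 0" by algebra
  moreover have "D \<noteq> 0" using nz unfolding D_def by simp
  ultimately show ?thesis by simp
qed

section \<open>The linear form at discriminant $-163$\<close>

theorem theorem1:
  fixes t \<alpha> S \<rho> lam \<mu> A B \<xi> z :: real
  assumes t: "t = (THE x::real. x ^ 3 + 262537412640768768 * x ^ 2 + 196608 * x + 16777216 = 0)"
    and \<alpha>: "\<alpha> = (THE y::real. 668649972819460401 * y ^ 3 + 50012252033677839 * y ^ 2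
                 + 1467 * y - 41450311432931 = 0)"
    and S: "S = (t - 64) / (t + 64)"
    and \<rho>: "\<rho> = sqrt ((t + 256) / (t + 64))"
    and lam: "lam = ((t + 256) * (64 - t)) / ((512 - t) * (t + 64))"
    and \<mu>: "\<mu> = - ((96 * t) / ((t + 256) * (64 - t)))"
    and A: "A = (\<alpha> - S * \<mu>) / \<rho>"
    and B: "B = S / (\<rho> * lam)"
    and \<xi>: "\<xi> = (256 * t) / (t + 64) ^ 2"
    and z: "z = (1728 * t ^ 2) / (t + 256) ^ 3"
  shows
    "(\<exists>!x::real. x ^ 3 + 262537412640768768 * x ^ 2 + 196608 * x + 16777216 = 0)
     \<and> t < 0 \<and> round t = - 262537412640768768
     \<and> (\<exists>!y::real. 668649972819460401 * y ^ 3 + 50012252033677839 * y ^ 2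
                 + 1467 * y - 41450311432931 = 0)
     \<and> \<alpha> > 0
     \<and> \<rho> > 0
     \<and> sqrt 163 * A = 13591409 / (426880 * sqrt 10005)
     \<and> sqrt 163 * B = 272570067 / (213440 * sqrt 10005)
     \<and> z = - (1 / 53360 ^ 3)
     \<and> sqrt 163 * (\<alpha> * F2 \<xi> + S * theta F2 \<xi>)
         = 13591409 / (426880 * sqrt 10005) * F1 z
           + 272570067 / (213440 * sqrt 10005) * theta F1 z"
proof -
  note t_unique = hauptmodul_cubic_root(1) and \<alpha>_unique = alpha_cubic_root(1)
  have t_root: "t ^ 3 + 262537412640768768 * t ^ 2 + 196608 * t + 16777216 = 0"
    unfolding t by (rule theI'[OF t_unique])
  have \<alpha>_root: "668649972819460401 * \<alpha> ^ 3 + 50012252033677839 * \<alpha> ^ 2 + 1467 * \<alpha> - 41450311432931 = 0"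
    unfolding \<alpha> by (rule theI'[OF \<alpha>_unique])
  have t_near: "\<bar>t + 262537412640768768\<bar> \<le> 1 / 4" by (rule hauptmodul_cubic_root(2)[OF t_root])
  then have t_round: "round t = - 262537412640768768" by (intro round_unique') simp
  have t_large: "t < - (10 ^ 6)" using t_near unfolding abs_le_iff by simp
  then have sgn: "t < 0" "t + 256 < 0" "t + 64 < 0" "t - 64 < 0" "t - 512 < 0" "64 - t > 0" "512 - t > 0"
    by auto
  have nz: "t \<noteq> 0" "t + 256 \<noteq> 0" "t + 64 \<noteq> 0" "t - 64 \<noteq> 0" "64 - t \<noteq> 0" "512 - t \<noteq> 0" "t - 512 \<noteq> 0"
    using t_large by auto
  have \<rho>_pos: "\<rho> > 0" unfolding \<rho> using sgn by (simp add: divide_neg_neg)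
  have \<rho>_sq: "\<rho> ^ 2 = (t + 256) / (t + 64)" unfolding \<rho> using sgn by (simp add: divide_nonpos_nonpos)
  have S_pos: "S > 0" unfolding S using sgn by (intro divide_neg_neg)
  have lam_pos: "lam > 0" unfolding lam using sgn by (intro divide_neg_neg mult_neg_pos mult_pos_neg)
  \<comment> \<open>The coefficient $262537412640768768$ is $640320^3 + 3 \cdot 256$, and $640320^3 = 1728 \cdot 53360^3$.\<close>
  have cube: "(t + 256) ^ 3 = - (640320 ^ 3) * t ^ 2"
    using t_root by algebra
  have z_val: "z = - (1 / 53360 ^ 3)"
    unfolding z cube using nz by simp

  have S_lam: "S / lam = (t - 512) / (t + 256)"
    unfolding S lam using nz by (simp add: divide_simps) algebra
  \<comment> \<open>The identity $(t+256)^3 - 1728t^2 = (t+64)(t-512)^2$ in disguise.\<close>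
  have "((t - 512) / (t + 256)) ^ 2 * ((t + 64) / (t + 256)) = 1 - z"
    unfolding z using nz by (simp add: divide_simps) algebra
  moreover have "B ^ 2 = (S / lam) ^ 2 * (1 / \<rho> ^ 2)"
    unfolding B by (simp add: power_divide power_mult_distrib)
  ultimately have "B ^ 2 = 1 - z" unfolding \<rho>_sq S_lam by simp
  then have "(sqrt 163 * B) ^ 2 = 163 * (1 + 1 / 53360 ^ 3)"
    by (simp add: power_mult_distrib z_val)
  also have "\<dots> = (272570067 / (213440 * sqrt 10005)) ^ 2"
    by (simp add: power_divide power_mult_distrib)
  finally have B_sq: "(sqrt 163 * B) ^ 2 = (272570067 / (213440 * sqrt 10005)) ^ 2" .
  have "0 < B" unfolding B using S_pos lam_pos \<rho>_pos by simp
  then have B_val: "sqrt 163 * B = 272570067 / (213440 * sqrt 10005)"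
    by (intro power2_eq_imp_eq[OF B_sq]) auto

  \<comment> \<open>The quotient of the two target values of $A$ and $B$; it turns the claim about $A$ into $A = kB$.\<close>
  define k :: real where "k = 13591409 / 545140134"
  have flip: "64 - t = - (t - 64)" by simp
  have S_mu: "S * \<mu> = 96 * t / ((t + 256) * (t + 64))"
    unfolding S \<mu> flip using nz by (simp del: minus_diff_eq)
  have S_mu_cleared: "S * \<mu> * (545140134 * ((t + 256) * (t + 64))) = 545140134 * (96 * t)"
    unfolding S_mu using nz by simp
  have S_lam_cleared: "S / lam * ((t + 256) * (t + 64)) = (t - 512) * (t + 64)"
    unfolding S_lam using nz by simp
  have "k * (S / lam) * (545140134 * ((t + 256) * (t + 64)))
      = (k * 545140134) * (S / lam * ((t + 256) * (t + 64)))"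
    by (simp only: mult_ac)
  also have "\<dots> = 13591409 * ((t - 512) * (t + 64))"
    unfolding S_lam_cleared k_def by simp
  finally have "(S * \<mu> + k * (S / lam)) * (545140134 * ((t + 256) * (t + 64)))
          = 545140134 * (96 * t) + 13591409 * ((t - 512) * (t + 64))"
    unfolding distrib_right[of "S * \<mu>" "k * (S / lam)"] S_mu_cleared by simp
  from alpha_cubic_of_hauptmodul_cubic[OF t_root nz(2,3) this] \<alpha>_root \<alpha>_unique
  have "\<alpha> = S * \<mu> + k * (S / lam)" by blast
  then have "A = k * B" unfolding A B by (simp add: mult.commute)
  then have "sqrt 163 * A = k * (sqrt 163 * B)" by simp
  then have A_val: "sqrt 163 * A = 13591409 / (426880 * sqrt 10005)"
    unfolding B_val k_def by simp

  define u where "u = 1 / t"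
  have u: "\<bar>u\<bar> \<le> 1 / 10 ^ 6" using t_large unfolding u_def by (simp add: divide_simps)
  have args: "level2_arg u = \<xi>" "level1_arg u = z" "level_factor u = \<rho>"
  proof -
    have d: "1 + 64 * u = (t + 64) / t" "1 + 256 * u = (t + 256) / t"
      using nz by (simp_all add: u_def divide_simps)
    show "level2_arg u = \<xi>" "level1_arg u = z" "level_factor u = \<rho>"
      unfolding level2_arg_def level1_arg_def level_factor_def \<xi> z \<rho> d using nz
      by (simp_all add: u_def power_divide power2_eq_square power3_eq_cube)
  qed
  have coeffs: "\<rho> / ((1 + 64 * u) * (1 - 512 * u)) * (96 * u * f + (1 + 256 * u) * (1 - 64 * u) * g)
      = \<rho> * lam * (\<mu> * f + g)" for f g
  proof -
    have "96 * u / ((1 + 64 * u) * (1 - 512 * u)) = lam * \<mu>"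
      unfolding lam \<mu> u_def using nz by (simp add: divide_simps) algebra
    moreover have "(1 + 256 * u) * (1 - 64 * u) / ((1 + 64 * u) * (1 - 512 * u)) = lam"
      unfolding lam u_def using nz by (simp add: divide_simps) algebra
    ultimately show ?thesis
      by (metis (no_types, opaque_lifting) add_divide_distrib distrib_left mult.assoc
          times_divide_eq_left times_divide_eq_right)
  qed
  have "A * F1 z + B * theta F1 z
      = (\<alpha> - S * \<mu>) / \<rho> * (\<rho> * F2 \<xi>) + S / (\<rho> * lam) * (\<rho> * lam * (\<mu> * F2 \<xi> + theta F2 \<xi>))"
    using F1_F2_transformation[OF u] unfolding args coeffs A B by simp
  also have "\<dots> = (\<alpha> - S * \<mu>) * F2 \<xi> + S * (\<mu> * F2 \<xi> + theta F2 \<xi>)"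
    using \<rho>_pos lam_pos by simp
  also have "\<dots> = \<alpha> * F2 \<xi> + S * theta F2 \<xi>" by algebra
  finally have "sqrt 163 * (\<alpha> * F2 \<xi> + S * theta F2 \<xi>)
      = (sqrt 163 * A) * F1 z + (sqrt 163 * B) * theta F1 z"
    by algebra
  then have form: "sqrt 163 * (\<alpha> * F2 \<xi> + S * theta F2 \<xi>)
         = 13591409 / (426880 * sqrt 10005) * F1 z
           + 272570067 / (213440 * sqrt 10005) * theta F1 z"
    unfolding A_val B_val .
  show ?thesis
    using t_unique sgn(1) t_round \<alpha>_unique alpha_cubic_root(2)[OF \<alpha>_root] \<rho>_pos A_val B_val z_val form
    by blast
qed

end
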